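(* Let $f, g \in \mathcal{N}$ satisfy $\frac{f(z)+g(z)}{z} \neq 0$ for all $z \in \mathbb{D}$. Then the function $F$ given by $$F(z) = \frac{2 f(z) g(z)}{f(z)+g(z)}, \quad z \in \mathbb{D},$$ also belongs to the class $\mathcal{N}$.
   Context: $\mathbb{D} = \{z \in \mathbb{C} : |z| < 1\}$ is the open unit disk. $\mathcal{A}$ is the class of analytic functions $f$ on $\mathbb{D}$ normalized by $f(0) = f'(0) - 1 = 0$, i.e. $f(z) = z + a_2 z^2 + a_3 z^3 + \cdots$. The class $\mathcal{N}$ consists of all $f \in \mathcal{A}$ satisfying $$\left| -z^3 \left( \frac{z}{f(z)} \right)''' + f'(z) \left( \frac{z}{f(z)} \right)^2 - 1 \right| \le 1, \quad z \in \mathbb{D}.$$ Here it is understood that $f(z) \ne 0$ for $0 < |z| < 1$, and that $z/f(z)$ is the analytic function on $\mathbb{D}$ with value $1$ at $z = 0$. Expressions such as $(f(z)+g(z))/z$ and $F(z)$ are taken at $z=0$ by their analytic extension (so $(f(z)+g(z))/z$ has value $2$ and $F$ has value $0$ at $z=0$). *)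

theory Defs
  imports "HOL-Complex_Analysis.Complex_Analysis"
begin

abbreviation unit_disk :: "complex set" where
  "unit_disk \<equiv> ball 0 1"

text \<open>
  Functions on the disk are total functions on the complex plane; only their values on the
  disk matter below.
\<close>

definition class_A :: "(complex \<Rightarrow> complex) set" where
  "class_A = {f. f holomorphic_on unit_disk \<and> f 0 = 0 \<and> deriv f 0 - 1 = 0}"

text \<open>
  In the next three definitions the value at the origin is that of the analytic extension
  (for functions in \<^term>\<open>class_A\<close>).
\<close>

definition z_over :: "(complex \<Rightarrow> complex) \<Rightarrow> complex \<Rightarrow> complex" where
  "z_over f z = (if z = 0 then 1 else z / f z)"

definition sum_over_z :: "(complex \<Rightarrow> complex) \<Rightarrow> (complex \<Rightarrow> complex) \<Rightarrow> complex \<Rightarrow> complex" where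
  "sum_over_z f g z = (if z = 0 then 2 else (f z + g z) / z)"

definition harmonic_mean ::
    "(complex \<Rightarrow> complex) \<Rightarrow> (complex \<Rightarrow> complex) \<Rightarrow> complex \<Rightarrow> complex" where
  "harmonic_mean f g z = (if z = 0 then 0 else 2 * f z * g z / (f z + g z))"

definition class_N :: "(complex \<Rightarrow> complex) set" where
  "class_N = {f \<in> class_A.
     (\<forall>z. 0 < norm z \<and> norm z < 1 \<longrightarrow> f z \<noteq> 0) \<and>
     (\<forall>z\<in>unit_disk.
        norm (- (z ^ 3) * (deriv ^^ 3) (z_over f) z + deriv f z * (z_over f z)\<^sup>2 - 1) \<le> 1)}"

end

theory Submission
  imports Defs
begin

text \<open>
  The defining inequality of \<^const>\<open>class_N\<close> is affine in \<open>u = z / f\<close>. Indeed \<open>f = z / u\<close>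
  gives \<open>f' u\<^sup>2 = u - z u'\<close>, so the inequality reads \<open>|L u - 1| \<le> 1\<close> for the linear operator
  \<open>L u = u - z u' - z\<^sup>3 u'''\<close>. The harmonic mean \<open>F\<close> of \<open>f\<close> and \<open>g\<close> is characterised by
  \<open>z / F = (z / f + z / g) / 2\<close>, so \<open>L (z / F) - 1\<close> is the midpoint of two points of the closed
  unit disk and lies there as well.

  To use this, membership of \<open>f\<close> in the class has to be expressed entirely through \<open>u\<close>
  (lemma \<open>class_N_iff_N_operator\<close>). The point is that analyticity and normalisation of \<open>f\<close> can be
  traded for analyticity of \<open>u\<close> with \<open>u 0 = 1\<close>. In one direction the singularity of \<open>z / f\<close> at the
  origin is removable because \<open>f\<close> has a simple zero there. In the other, \<open>f = z / u\<close> is analytic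
  because \<open>u\<close> has no zeros. For \<open>F\<close> the hypothesis
  \<open>(f + g) / z \<noteq> 0\<close> says that \<open>z / F\<close> has no zeros, that is, \<open>F\<close> has no poles.
\<close>

definition N_operator :: "(complex \<Rightarrow> complex) \<Rightarrow> complex \<Rightarrow> complex" where
  "N_operator u z = u z - z * deriv u z - z ^ 3 * (deriv ^^ 3) u z"

lemma N_operator_midpoint:
  assumes u: "u holomorphic_on S" and v: "v holomorphic_on S"
    and S: "open S" and z: "z \<in> S"
  shows "N_operator (\<lambda>z. 1/2 * (u z + v z)) z = (N_operator u z + N_operator v z) / 2"
proof -
  have "(deriv ^^ n) (\<lambda>z. 1/2 * (u z + v z)) z = 1/2 * ((deriv ^^ n) u z + (deriv ^^ n) v z)" for n
    using higher_deriv_cmult[OF _ z S, of "\<lambda>z. u z + v z" n "1/2"]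
      higher_deriv_add[OF u v S z, of n] u v
    by (simp add: holomorphic_on_add)
  from this[of 1] this[of 3]
  have "deriv (\<lambda>z. 1/2 * (u z + v z)) z = 1/2 * (deriv u z + deriv v z)"
    and "(deriv ^^ 3) (\<lambda>z. 1/2 * (u z + v z)) z = 1/2 * ((deriv ^^ 3) u z + (deriv ^^ 3) v z)"
    by simp_all
  then show ?thesis
    unfolding N_operator_def
    by (simp only:) (simp add: algebra_simps add_divide_distrib diff_divide_distrib)
qed

lemma N_operator_cong:
  assumes "u holomorphic_on S" "v holomorphic_on S" "open S"
    and "\<And>z. z \<in> S \<Longrightarrow> u z = v z" and "z \<in> S"
  shows "N_operator u z = N_operator v z"
  using higher_deriv_transform_within_open[OF assms(1,2,3,5), of 1]
    higher_deriv_transform_within_open[OF assms(1,2,3,5), of 3] assms(4,5)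
  by (simp add: N_operator_def)

text \<open>
  \<open>f z / z\<close> extends analytically over the origin, and its value there is \<open>f' 0 = 1\<close>, so its
  reciprocal is analytic with exactly the value \<open>1\<close> prescribed in \<^const>\<open>z_over\<close>.
\<close>

lemma z_over_holomorphic:
  assumes A: "f \<in> class_A" and nz: "\<And>z. 0 < norm z \<Longrightarrow> norm z < 1 \<Longrightarrow> f z \<noteq> 0"
  shows "z_over f holomorphic_on unit_disk"
proof -
  let ?h = "\<lambda>z. if z = 0 then deriv f 0 else (f z - f 0) / (z - 0)"
  have "?h holomorphic_on unit_disk"
    using A pole_theorem_open_0[of f unit_disk 0 ?h]
    by (auto simp: class_A_def)
  moreover have "?h z \<noteq> 0" if "z \<in> unit_disk" for z
    using that nz[of z] A by (auto simp: class_A_def)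
  ultimately have "(\<lambda>z. 1 / ?h z) holomorphic_on unit_disk"
    by (intro holomorphic_intros) auto
  moreover have "(\<lambda>z. 1 / ?h z) = z_over f"
    using A by (auto simp: class_A_def z_over_def)
  ultimately show ?thesis by simp
qed

text \<open>
  This identity makes the second term of the defining inequality linear in \<open>u\<close>. At \<open>z = 0\<close> it
  also determines \<open>f' 0\<close> from \<open>u 0\<close>.
\<close>

lemma deriv_z_divide:
  assumes hol: "u holomorphic_on S" and S: "open S" and nz: "u z \<noteq> 0"
    and fu: "\<And>z. z \<in> S \<Longrightarrow> f z = z / u z" and z: "z \<in> S"
  shows "deriv f z * (u z)\<^sup>2 = u z - z * deriv u z"
proof -
  have "((\<lambda>z. z / u z) has_field_derivative (1 * u z - z * deriv u z) / (u z * u z)) (at z)"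
    by (intro DERIV_divide DERIV_ident holomorphic_derivI[OF hol S z] nz)
  then have "(f has_field_derivative (1 * u z - z * deriv u z) / (u z * u z)) (at z)"
    by (rule has_field_derivative_transform_within_open[OF _ S z]) (simp add: fu)
  then show ?thesis
    using nz by (simp add: DERIV_imp_deriv power2_eq_square)
qed

text \<open>
  Every condition on \<open>f'\<close> disappears here: the identity above recovers \<open>f'\<close> from \<open>z / f\<close>, and the
  normalisation \<open>f' 0 = 1\<close> is built into the value \<open>1\<close> of \<^const>\<open>z_over\<close> at the origin. The condition \<open>f 0 = 0\<close> must be kept,
  since \<^const>\<open>z_over\<close> does not look at the value of \<open>f\<close> at the origin.
\<close>

lemma class_N_iff_N_operator:
  "f \<in> class_N \<longleftrightarrow>
     f 0 = 0 \<and> z_over f holomorphic_on unit_disk \<and>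
     (\<forall>z. 0 < norm z \<and> norm z < 1 \<longrightarrow> f z \<noteq> 0) \<and>
     (\<forall>z\<in>unit_disk. norm (N_operator (z_over f) z - 1) \<le> 1)"
  (is "_ \<longleftrightarrow> ?zero \<and> ?hol \<and> ?nz \<and> ?bound")
proof (cases "?zero \<and> ?hol \<and> ?nz")
  case True
  then have zero: ?zero and hol: ?hol and nz: ?nz by auto
  have u_nz: "z_over f z \<noteq> 0" if "z \<in> unit_disk" for z
    using that nz by (auto simp: z_over_def)
  have fu: "f z = z / z_over f z" if "z \<in> unit_disk" for z
    using that nz zero by (auto simp: z_over_def)
  have der: "deriv f z * (z_over f z)\<^sup>2 = z_over f z - z * deriv (z_over f) z"
    if "z \<in> unit_disk" for z
    by (rule deriv_z_divide[OF hol open_ball u_nz[OF that] fu that])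
  have "(\<lambda>z. z / z_over f z) holomorphic_on unit_disk"
    by (intro holomorphic_intros hol u_nz)
  then have "f holomorphic_on unit_disk"
    using fu by (metis (no_types, lifting) holomorphic_cong)
  moreover have "deriv f 0 = 1"
    using der[of 0] by (simp add: z_over_def)
  ultimately have "f \<in> class_A"
    using zero by (simp add: class_A_def)
  moreover have "- (z ^ 3) * (deriv ^^ 3) (z_over f) z + deriv f z * (z_over f z)\<^sup>2 - 1
      = N_operator (z_over f) z - 1" if "z \<in> unit_disk" for z
    unfolding der[OF that] N_operator_def by simp
  ultimately show ?thesis
    using True by (simp add: class_N_def)
next
  case False
  then show ?thesis
    using z_over_holomorphic[of f] by (auto simp: class_N_def class_A_def)
qed

lemma z_over_harmonic_mean:
  assumes "z = 0 \<or> f z \<noteq> 0" "z = 0 \<or> g z \<noteq> 0"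
  shows "z_over (harmonic_mean f g) z = 1/2 * (z_over f z + z_over g z)"
  using assms by (auto simp: z_over_def harmonic_mean_def field_simps)

theorem theorem3:
  fixes f g :: "complex \<Rightarrow> complex"
  assumes "f \<in> class_N" and "g \<in> class_N"
    and "\<forall>z\<in>unit_disk. sum_over_z f g z \<noteq> 0"
  shows "harmonic_mean f g \<in> class_N"
proof -
  let ?F = "harmonic_mean f g" and ?w = "\<lambda>z. 1/2 * (z_over f z + z_over g z)"
  have f: "z_over f holomorphic_on unit_disk" "\<And>z. 0 < norm z \<Longrightarrow> norm z < 1 \<Longrightarrow> f z \<noteq> 0"
      "\<And>z. z \<in> unit_disk \<Longrightarrow> norm (N_operator (z_over f) z - 1) \<le> 1"
    and g: "z_over g holomorphic_on unit_disk" "\<And>z. 0 < norm z \<Longrightarrow> norm z < 1 \<Longrightarrow> g z \<noteq> 0"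
      "\<And>z. z \<in> unit_disk \<Longrightarrow> norm (N_operator (z_over g) z - 1) \<le> 1"
    using assms(1,2) by (auto simp: class_N_iff_N_operator)
  have Fw: "z_over ?F z = ?w z" if "z \<in> unit_disk" for z
    using that f(2)[of z] g(2)[of z] by (intro z_over_harmonic_mean) auto
  have w_hol: "?w holomorphic_on unit_disk"
    by (intro holomorphic_intros f g)
  then have F_hol: "z_over ?F holomorphic_on unit_disk"
    using Fw by (metis (no_types, lifting) holomorphic_cong)
  have F_nz: "?F z \<noteq> 0" if "0 < norm z" "norm z < 1" for z
    using that f(2)[of z] g(2)[of z] assms(3)
    by (auto simp: harmonic_mean_def sum_over_z_def split: if_splits)
  have "norm (N_operator (z_over ?F) z - 1) \<le> 1" if z: "z \<in> unit_disk" for z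
  proof -
    have "N_operator (z_over ?F) z - 1
        = ((N_operator (z_over f) z - 1) + (N_operator (z_over g) z - 1)) / 2"
      using N_operator_cong[OF F_hol w_hol open_ball Fw z] N_operator_midpoint[OF f(1) g(1) open_ball z]
      by (simp add: field_simps)
    moreover have "norm ((N_operator (z_over f) z - 1) + (N_operator (z_over g) z - 1)) \<le> 1 + 1"
      by (intro norm_triangle_mono f(3) g(3) z)
    ultimately show ?thesis
      by (simp only: norm_divide) simp
  qed
  with F_hol F_nz show ?thesis
    by (simp add: class_N_iff_N_operator harmonic_mean_def)
qed

end
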